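(* Let $\mathcal{H}$ be a real Hilbert space and let $f:\mathcal{H}\to\mathbb{R}$ be convex, of class $\mathcal{C}^1$, with $\nabla f$ Lipschitz continuous on bounded subsets of $\mathcal{H}$, and with $S:=\operatorname{argmin}_{\mathcal{H}} f\neq\emptyset$. Let $x^*$ be the element of minimum norm of $S$. Let $\alpha>3$, $\delta>1$ (so that $\alpha+2\delta>5$), and $t_0>0$. Let $x:[t_0,+\infty[\to\mathcal{H}$ be a solution trajectory of $$\ddot x(t)+\frac{\alpha+2\delta}{t}\,\dot x(t)+\nabla f\left(x(t)+\frac{t}{\alpha-1}\dot x(t)\right)+\frac{2\delta(\alpha-1)}{t^2}\,x(t)=0 .$$ Then the following properties are satisfied: (i) $f(x(t))-\min_{\mathcal{H}} f=\mathcal{O}\left(\frac{1}{t^2}\right)$ as $t\to+\infty$; (ii) $x(t)$ converges strongly (in norm) to the minimum norm solution $x^*$ as $t\to+\infty$; (iii) $\|\nabla f(x(t))\|=\mathcal{O}\left(\frac1t\right)$ as $t\to+\infty$.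
   Context: A solution trajectory is a function of class $\mathcal{C}^2$ on $[t_0,+\infty[$ satisfying the differential equation for all $t\ge t_0$ (with arbitrary initial data). $\mathcal{O}(g(t))$ means bounded by a constant times $g(t)$ for $t$ large, where the constant may depend on the trajectory. *)

theory Defs
  imports "HOL-Analysis.Analysis" "HOL-Library.Landau_Symbols"
begin

definition argmin_set :: "('a \<Rightarrow> real) \<Rightarrow> 'a set" where
  "argmin_set f = {y. is_arg_min f (\<lambda>_. True) y}"

text \<open>Class \<open>C\<^sup>1\<close> on the whole space: Frechet differentiable, with derivative continuous
  for the operator norm.\<close>

definition class_C1 :: "('a::real_normed_vector \<Rightarrow> real) \<Rightarrow> bool" where
  "class_C1 f \<longleftrightarrow>
     (\<exists>f' :: 'a \<Rightarrow> 'a \<Rightarrow>\<^sub>L real.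
        (\<forall>y. (f has_derivative blinfun_apply (f' y)) (at y)) \<and> continuous_on UNIV f')"

text \<open>The description is proper at every point of differentiability when the space is complete
  (Riesz representation).\<close>

definition gradient :: "('a::real_inner \<Rightarrow> real) \<Rightarrow> 'a \<Rightarrow> 'a" where
  "gradient f y = (THE g. GDERIV f y :> g)"

definition lipschitz_on_bounded_sets :: "('a::metric_space \<Rightarrow> 'b::metric_space) \<Rightarrow> bool" where
  "lipschitz_on_bounded_sets F \<longleftrightarrow> (\<forall>B. bounded B \<longrightarrow> (\<exists>L. L-lipschitz_on B F))"

text \<open>\<open>v\<close> and \<open>a\<close> are the first and second derivatives of \<open>x\<close> on \<open>{t0..}\<close>, one-sided at \<open>t0\<close>;
  the function \<open>x\<close> is unconstrained to the left of \<open>t0\<close>.\<close>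

definition solution_trajectory ::
    "('a::real_inner \<Rightarrow> real) \<Rightarrow> real \<Rightarrow> real \<Rightarrow> real \<Rightarrow> (real \<Rightarrow> 'a) \<Rightarrow> bool" where
  "solution_trajectory f \<alpha> \<delta> t0 x \<longleftrightarrow>
     (\<exists>v a.
        (\<forall>t\<ge>t0. (x has_vector_derivative v t) (at t within {t0..})) \<and>
        (\<forall>t\<ge>t0. (v has_vector_derivative a t) (at t within {t0..})) \<and>
        continuous_on {t0..} a \<and>
        (\<forall>t\<ge>t0. a t + ((\<alpha> + 2 * \<delta>) / t) *\<^sub>R v t
                  + gradient f (x t + (t / (\<alpha> - 1)) *\<^sub>R v t)
                  + (2 * \<delta> * (\<alpha> - 1) / t\<^sup>2) *\<^sub>R x t = 0))"

end

theory Submission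
  imports Defs
begin

text \<open>
  Put \<open>\<beta> = \<alpha> - 1\<close> and \<open>y t = x t + (t / \<beta>) x'(t)\<close>. In these variables the second-order equation
  splits into two first-order equations,
    \<open>x' = (\<beta> / t) (y - x)\<close> and
    \<open>y' = - (t / \<beta>) (\<nabla>f y + \<epsilon> y)\<close> with \<open>\<epsilon> t = 2 \<delta> \<beta> / t\<^sup>2\<close>.
  The second one is, up to the change of time \<open>s = t\<^sup>2 / (2 \<beta>)\<close>, the steepest descent of \<open>f\<close> with the
  vanishing Tikhonov term \<open>(\<delta> / s) y\<close>; the first one says that \<open>x\<close> is a weighted mean of the past
  of \<open>y\<close>. So the properties are proved for \<open>y\<close> and then carried over to \<open>x\<close>.

  All estimates have the form \<open>k' \<le> (p / t) (C - k)\<close>; for constant \<open>C\<close> this makes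
  \<open>t powr p * (k - C)\<close> nonincreasing (\<open>euler_comparison\<close>). Let \<open>z\<close> be the minimizer of least norm.

  \<^item> Value rate of \<open>y\<close>: the energy
    \<open>t\<^sup>2 (f y - f z) / (2 \<beta> (\<delta> + 1)) + \<delta> \<parallel>y\<parallel>\<^sup>2 / (2 (\<delta> + 1)) + \<parallel>y - z\<parallel>\<^sup>2 / 2\<close> satisfies such an inequality
    with \<open>p = 2 \<delta>\<close> and \<open>C = \<parallel>z\<parallel>\<^sup>2 / 2\<close>, hence stays bounded, and \<open>f y - f z = O(1/t\<^sup>2)\<close>
    (\<open>tikhonov_flow_value_rate\<close>).
  \<^item> Strong convergence of \<open>y\<close>: \<open>k = \<parallel>y - z\<parallel>\<^sup>2 / 2\<close> satisfies
    \<open>k' \<le> (2 \<delta> / t) ((\<parallel>z\<parallel>\<^sup>2 - \<parallel>y\<parallel>\<^sup>2) / 2 - k)\<close>. Since \<open>f y\<close> tends to the minimum, \<open>\<parallel>y\<parallel>\<close> cannot stay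
    below \<open>\<parallel>z\<parallel>\<close> by a fixed amount (\<open>ex_sublevel_norm_gt\<close>), so the upper limit of the forcing term is
    at most \<open>0\<close> and \<open>k\<close> tends to \<open>0\<close> (\<open>tikhonov_flow_tendsto_min_norm\<close>).
  \<^item> Passage to \<open>x\<close>: by convexity \<open>\<parallel>x - z\<parallel>\<^sup>2 / 2\<close> and \<open>f x - f z\<close> relax towards the corresponding
    quantities of \<open>y\<close> at rate \<open>\<beta> / t\<close>. The limit is inherited, and so is the rate \<open>1/t\<^sup>2\<close> because
    \<open>\<beta> > 2\<close>.
  \<^item> Gradient: on a bounded set \<open>\<parallel>\<nabla>f\<parallel>\<^sup>2\<close> is at most a constant times the gap \<open>f - f z\<close>
    (\<open>gradient_norm_le_gap\<close>), so its rate follows from that of the values.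

  The Hilbert space theory behind this (least-norm elements, representation of the derivative by the
  gradient, and the lower bound on \<open>\<parallel>y\<parallel>\<close>) all rests on one compactness principle: a decreasing
  sequence of nonempty bounded closed convex sets has a common point.
\<close>

section \<open>Bounded closed convex sets in Hilbert spaces\<close>

text \<open>This replaces weak compactness of bounded closed convex sets. Points of almost minimal norm in
  the successive sets form a Cauchy sequence: the midpoint of two of them lies in the larger set, so
  its norm is bounded below, and the parallelogram identity makes their distance small.\<close>

lemma nested_closed_convex_bounded_Inter_nonempty:
  fixes C :: "nat \<Rightarrow> 'a::{real_inner, complete_space} set"
  assumes ne: "\<And>n. C n \<noteq> {}" and cl: "\<And>n. closed (C n)" and cv: "\<And>n. convex (C n)"
    and dec: "\<And>m n. m \<le> n \<Longrightarrow> C n \<subseteq> C m" and bd: "bounded (C 0)"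
  shows "(\<Inter>n. C n) \<noteq> {}"
proof -
  obtain B where B: "\<And>z. z \<in> C 0 \<Longrightarrow> norm z \<le> B"
    using bd by (auto simp: bounded_iff)
  define d where "d n = Inf (norm ` C n)" for n
  have bb: "bdd_below (norm ` C n)" for n
    by (rule bdd_belowI[of _ 0]) auto
  have d_le: "d n \<le> norm z" if "z \<in> C n" for n z
    unfolding d_def using that bb by (auto intro: cInf_lower)
  have d_nonneg: "0 \<le> d n" for n
    unfolding d_def using ne by (auto intro: cInf_greatest)
  have "\<exists>z\<in>C n. norm z < d n + 1 / real (Suc n)" for n
    using cInf_lessD[of "norm ` C n" "d n + 1 / real (Suc n)"] ne[of n]
    unfolding d_def by (auto simp del: of_nat_Suc)
  then obtain u where uC: "\<And>n. u n \<in> C n" and u: "\<And>n. norm (u n) < d n + 1 / real (Suc n)"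
    by metis
  have "d m \<le> d n" if "m \<le> n" for m n
    unfolding d_def using dec[OF that] ne bb by (intro cInf_superset_mono) auto
  then have "incseq d"
    by (auto simp: incseq_def)
  moreover have "d n \<le> B" for n
    using d_le[OF uC[of n]] B[of "u n"] dec[of 0 n] uC[of n] by auto
  ultimately obtain l where l: "d \<longlonglongrightarrow> l"
    using incseq_convergent by metis
  have "(\<lambda>n. d n + 1 / real (Suc n)) \<longlonglongrightarrow> l + 0"
    by (intro tendsto_add l LIMSEQ_Suc[OF lim_1_over_n])
  then have "(\<lambda>n. norm (u n)) \<longlonglongrightarrow> l"
    by (intro tendsto_sandwich[OF _ _ l, of "\<lambda>n. norm (u n)" "\<lambda>n. d n + 1 / real (Suc n)"])
       (auto intro!: always_eventually less_imp_le[OF u] d_le uC simp del: of_nat_Suc)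
  then have u2: "(\<lambda>n. (norm (u n))\<^sup>2) \<longlonglongrightarrow> l\<^sup>2"
    by (intro tendsto_power)
  have d2: "(\<lambda>n. (d n)\<^sup>2) \<longlonglongrightarrow> l\<^sup>2"
    by (intro tendsto_power l)
  have gap: "(dist (u m) (u n))\<^sup>2 \<le> 2 * ((norm (u m))\<^sup>2 - (d m)\<^sup>2) + 2 * ((norm (u n))\<^sup>2 - (d m)\<^sup>2)"
    if "m \<le> n" for m n
  proof -
    \<comment> \<open>parallelogram identity for \<open>u m\<close> and \<open>u n\<close>\<close>
    have "(1/2) *\<^sub>R u m + (1/2) *\<^sub>R u n \<in> C m"
      using cv[of m] uC[of m] uC[of n] dec[OF that] by (intro convexD) auto
    then have "(d m)\<^sup>2 \<le> (norm ((1/2) *\<^sub>R u m + (1/2) *\<^sub>R u n))\<^sup>2"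
      using d_nonneg d_le by (intro power_mono) auto
    then show ?thesis
      by (auto simp: dist_norm power2_norm_eq_inner inner_simps inner_commute[of "u n" "u m"] field_simps)
  qed
  have "Cauchy u"
  proof (rule CauchyI)
    fix e :: real
    assume "e > 0"
    then have e: "e\<^sup>2 / 8 > 0" by simp
    have "\<forall>\<^sub>F n in sequentially. dist ((norm (u n))\<^sup>2) (l\<^sup>2) < e\<^sup>2 / 8 \<and> dist ((d n)\<^sup>2) (l\<^sup>2) < e\<^sup>2 / 8"
      using tendstoD[OF u2 e] tendstoD[OF d2 e] by (rule eventually_conj)
    then obtain N where N: "\<And>n. n \<ge> N \<Longrightarrow>
        dist ((norm (u n))\<^sup>2) (l\<^sup>2) < e\<^sup>2 / 8 \<and> dist ((d n)\<^sup>2) (l\<^sup>2) < e\<^sup>2 / 8"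
      by (auto simp: eventually_sequentially)
    have close: "dist (u m) (u n) < e" if "N \<le> m" "m \<le> n" for m n
    proof -
      have "(dist (u m) (u n))\<^sup>2 < e\<^sup>2"
        using gap[OF that(2)] N[OF that(1)] N[OF order_trans[OF that]]
        unfolding dist_real_def abs_less_iff by argo
      then show ?thesis
        using \<open>e > 0\<close> by (simp add: power_less_imp_less_base)
    qed
    have "norm (u m - u n) < e" if "N \<le> m" "N \<le> n" for m n
      using close[of m n] close[of n m] that
      by (cases "m \<le> n") (auto simp: dist_norm norm_minus_commute)
    then show "\<exists>N. \<forall>m\<ge>N. \<forall>n\<ge>N. norm (u m - u n) < e"
      by blast
  qed
  then obtain p where p: "u \<longlonglongrightarrow> p"
    by (auto simp: Cauchy_convergent_iff convergent_def)
  have "p \<in> C m" for m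
  proof (rule Lim_in_closed_set[OF cl[of m] _ _ p])
    show "\<forall>\<^sub>F n in sequentially. u n \<in> C m"
      using eventually_ge_at_top[of m] by eventually_elim (use uC dec in blast)
  qed simp
  then show ?thesis by blast
qed

lemma ex_min_norm:
  fixes S :: "'a::{real_inner, complete_space} set"
  assumes "closed S" "convex S" "S \<noteq> {}"
  obtains p where "p \<in> S" "\<And>z. z \<in> S \<Longrightarrow> norm p \<le> norm z"
proof -
  define r where "r = Inf (norm ` S)"
  define C where "C n = S \<inter> cball 0 (r + 1 / real (Suc n))" for n
  have "(\<Inter>n. C n) \<noteq> {}"
  proof (rule nested_closed_convex_bounded_Inter_nonempty)
    fix n
    show "C n \<noteq> {}"
      using cInf_lessD[of "norm ` S" "r + 1 / real (Suc n)"] assms(3)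
      unfolding r_def C_def by (force simp del: of_nat_Suc)
    show "closed (C n)" "convex (C n)"
      unfolding C_def using assms by (auto intro: closed_Int convex_Int)
  next
    show "C n \<subseteq> C m" if "m \<le> n" for m n
    proof -
      have "1 / real (Suc n) \<le> 1 / real (Suc m)"
        using that by (intro divide_left_mono) auto
      then show ?thesis
        unfolding C_def by (auto simp del: of_nat_Suc)
    qed
  next
    show "bounded (C 0)"
      unfolding C_def by (rule bounded_subset[OF bounded_cball]) auto
  qed
  then obtain p where p: "\<And>n. p \<in> C n" by blast
  have "(\<lambda>n. r + 1 / real (Suc n)) \<longlonglongrightarrow> r + 0"
    by (intro tendsto_add tendsto_const LIMSEQ_Suc[OF lim_1_over_n])
  moreover have "norm p \<le> r + 1 / real (Suc n)" for n
    using p[of n] by (simp add: C_def del: of_nat_Suc)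
  ultimately have "norm p \<le> r"
    using LIMSEQ_le_const[of "\<lambda>n. r + 1 / real (Suc n)" r "norm p"] by auto
  moreover have "r \<le> norm z" if "z \<in> S" for z
    unfolding r_def using that by (intro cInf_lower bdd_belowI[of _ 0]) auto
  ultimately show ?thesis
    using that[of p] p[of 0] by (force simp: C_def)
qed

text \<open>The representing vector is a multiple of the point \<open>p\<close> of least norm in the hyperplane
  \<open>\<phi> = 1\<close>: minimality makes \<open>p\<close> orthogonal to the kernel of \<open>\<phi>\<close>.\<close>

lemma riesz_representation:
  fixes \<phi> :: "'a::{real_inner, complete_space} \<Rightarrow> real"
  assumes "bounded_linear \<phi>"
  obtains g where "\<And>h. \<phi> h = inner h g"
proof (cases "\<forall>h. \<phi> h = 0")
  case True
  then show ?thesis using that[of 0] by simp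
next
  case False
  interpret bounded_linear \<phi> by fact
  define S where "S = {h. \<phi> h = 1}"
  from False obtain w where "\<phi> w \<noteq> 0" by blast
  then have "(1 / \<phi> w) *\<^sub>R w \<in> S"
    by (simp add: S_def scaleR)
  then have "S \<noteq> {}" by blast
  moreover have "closed S"
    unfolding S_def
    using linear_continuous_on[OF assms, of UNIV]
    by (intro closed_Collect_eq) auto
  moreover have "convex S"
    unfolding S_def convex_def by (auto simp: add scaleR)
  ultimately obtain p where p: "p \<in> S" "\<And>z. z \<in> S \<Longrightarrow> norm p \<le> norm z"
    using ex_min_norm by blast
  have "p \<noteq> 0" using p(1) zero by (auto simp: S_def)
  have orth: "inner v p = 0" if "\<phi> v = 0" for v
  proof (cases "v = 0")
    case False
    \<comment> \<open>the step along \<open>v\<close> that minimizes the norm\<close>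
    define s where "s = - inner v p / inner v v"
    have "p + s *\<^sub>R v \<in> S"
      using p(1) that by (simp add: S_def add scaleR)
    then have "(norm p)\<^sup>2 \<le> (norm (p + s *\<^sub>R v))\<^sup>2"
      using p(2) by (intro power_mono) auto
    also have "\<dots> = (norm p)\<^sup>2 + 2 * s * inner v p + s * (s * inner v v)"
      by (simp add: power2_norm_eq_inner inner_simps inner_commute[of p v] algebra_simps)
    also have "\<dots> = (norm p)\<^sup>2 - (inner v p)\<^sup>2 / inner v v"
      using False by (simp add: s_def power2_eq_square)
    finally have "(inner v p)\<^sup>2 / inner v v \<le> 0" by simp
    moreover have "inner v v > 0" using False by simp
    ultimately show ?thesis
      by (simp add: divide_le_0_iff)
  qed simp
  have "\<phi> h = inner h ((1 / (norm p)\<^sup>2) *\<^sub>R p)" for h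
  proof -
    have "\<phi> (h - \<phi> h *\<^sub>R p) = 0"
      using p(1) by (simp add: S_def diff scaleR)
    from orth[OF this] show ?thesis
      using \<open>p \<noteq> 0\<close> by (simp add: inner_simps power2_norm_eq_inner field_simps)
  qed
  then show ?thesis using that by blast
qed

section \<open>Gradients of convex functions\<close>

lemma GDERIV_gradient:
  fixes f :: "'a::{real_inner, complete_space} \<Rightarrow> real"
  assumes "class_C1 f"
  shows "GDERIV f y :> gradient f y"
proof -
  obtain f' where f': "(f has_derivative blinfun_apply (f' y)) (at y)"
    using assms unfolding class_C1_def by blast
  obtain g where g: "\<And>h. blinfun_apply (f' y) h = inner h g"
    using riesz_representation[OF blinfun.bounded_linear_right] by blast
  have "blinfun_apply (f' y) = (\<lambda>h. inner h g)"
    using g by auto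
  then have "GDERIV f y :> g"
    using f' unfolding gderiv_def by simp
  moreover have "g' = g" if "GDERIV f y :> g'" for g'
  proof -
    have "(\<lambda>h. inner h g') = (\<lambda>h. inner h g)"
      using that \<open>GDERIV f y :> g\<close> unfolding gderiv_def by (rule has_derivative_unique)
    then have "inner h (g' - g) = 0" for h
      by (simp add: inner_diff_right fun_eq_iff)
    from this[of "g' - g"] show ?thesis by simp
  qed
  ultimately show ?thesis
    unfolding gradient_def by (rule theI)
qed

lemma GDERIV_imp_continuous_on:
  assumes "\<And>w. GDERIV f w :> g w"
  shows "continuous_on S f"
  using assms unfolding gderiv_def
  by (intro continuous_at_imp_continuous_on ballI) (rule has_derivative_continuous)

lemma convex_sublevel:
  assumes "convex_on UNIV f"
  shows "convex {w. f w \<le> c}"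
  unfolding convex_def
proof (clarify)
  fix a b and u v :: real
  assume ab: "f a \<le> c" "f b \<le> c" and uv: "0 \<le> u" "0 \<le> v" "u + v = 1"
  have "f (u *\<^sub>R a + v *\<^sub>R b) \<le> u * f a + v * f b"
    using assms uv unfolding convex_on_def by blast
  also have "\<dots> \<le> c"
    using ab uv by (intro convex_bound_le)
  finally show "f (u *\<^sub>R a + v *\<^sub>R b) \<le> c" .
qed

lemma convex_on_gradient_inequality:
  fixes f :: "'a::real_inner \<Rightarrow> real"
  assumes cvx: "convex_on UNIV f" and g: "GDERIV f y :> g"
  shows "f z \<ge> f y + inner g (z - y)"
proof -
  define \<psi> where "\<psi> s = f (y + s *\<^sub>R (z - y))" for s :: real
  have "convex_on UNIV \<psi>"
  proof (rule convex_onI)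
    fix t a b :: real
    assume t: "0 < t" "t < 1"
    have "y + ((1 - t) *\<^sub>R a + t *\<^sub>R b) *\<^sub>R (z - y)
        = (1 - t) *\<^sub>R (y + a *\<^sub>R (z - y)) + t *\<^sub>R (y + b *\<^sub>R (z - y))"
      by (simp add: algebra_simps)
    then show "\<psi> ((1 - t) *\<^sub>R a + t *\<^sub>R b) \<le> (1 - t) * \<psi> a + t * \<psi> b"
      unfolding \<psi>_def using convex_onD[OF cvx, of t] t by simp
  qed simp
  moreover have "(\<psi> has_real_derivative inner g (z - y)) (at 0)"
  proof -
    have "((\<lambda>s. y + s *\<^sub>R (z - y)) has_derivative (\<lambda>s. s *\<^sub>R (z - y))) (at 0)"
      by (auto intro!: derivative_eq_intros)
    from has_derivative_compose[OF this, of f "\<lambda>h. inner h g"] g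
    have "(\<psi> has_derivative (\<lambda>s. inner (s *\<^sub>R (z - y)) g)) (at 0)"
      unfolding \<psi>_def gderiv_def by simp
    moreover have "(\<lambda>s. inner (s *\<^sub>R (z - y)) g) = (*) (inner g (z - y))"
      by (auto simp: inner_commute)
    ultimately show ?thesis
      by (simp add: has_field_derivative_def)
  qed
  ultimately have "\<psi> 1 - \<psi> 0 \<ge> inner g (z - y) * (1 - 0)"
    by (intro convex_on_imp_above_tangent[where A = UNIV]) auto
  then show ?thesis by (simp add: \<psi>_def)
qed

text \<open>One gradient step of length \<open>1 / (2 L)\<close> from \<open>w\<close> lowers \<open>f\<close> by at least
  \<open>\<parallel>\<nabla>f w\<parallel>\<^sup>2 / (4 L)\<close>, and no step can go below a lower bound \<open>m\<close>. The constant \<open>L\<close> has to be a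
  Lipschitz constant on a ball that contains the end point of the step as well; the gradient is
  bounded on \<open>B\<close>, so such a ball exists.\<close>

lemma gradient_norm_le_gap:
  fixes f :: "'a::real_inner \<Rightarrow> real"
  assumes cvx: "convex_on UNIV f" and df: "\<And>w. GDERIV f w :> g w"
    and lip: "lipschitz_on_bounded_sets g" and bd: "bounded B"
  obtains L where "L > 0" "\<And>w m. w \<in> B \<Longrightarrow> (\<And>u. m \<le> f u) \<Longrightarrow> (norm (g w))\<^sup>2 \<le> 4 * L * (f w - m)"
proof -
  obtain R where R: "\<And>w. w \<in> B \<Longrightarrow> norm w \<le> R"
    using bd by (auto simp: bounded_iff)
  obtain L0 where L0: "L0-lipschitz_on (insert 0 B) g"
    using lip bd unfolding lipschitz_on_bounded_sets_def by (meson bounded_insert)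
  define G where "G = norm (g 0) + L0 * R"
  have G: "norm (g w) \<le> G" if "w \<in> B" for w
  proof -
    have "norm (g w - g 0) \<le> L0 * norm w"
      using lipschitz_onD[OF L0, of w 0] that by (simp add: dist_norm)
    also have "\<dots> \<le> L0 * R"
      using R[OF that] lipschitz_on_nonneg[OF L0] by (rule mult_left_mono)
    finally show ?thesis
      using norm_triangle_sub[of "g w" "g 0"] by (simp add: G_def)
  qed
  obtain L1 where L1: "L1-lipschitz_on (cball 0 (R + G)) g"
    using lip unfolding lipschitz_on_bounded_sets_def by blast
  \<comment> \<open>\<open>L \<ge> 1\<close> keeps the step length below \<open>1\<close>, so that the step stays in the ball of radius \<open>R + G\<close>\<close>
  define L where "L = max L1 1"
  have L: "L-lipschitz_on (cball 0 (R + G)) g" "L \<ge> 1"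
    using lipschitz_on_le[OF L1] by (auto simp: L_def)
  have "(norm (g w))\<^sup>2 \<le> 4 * L * (f w - m)" if "w \<in> B" and m: "\<And>u. m \<le> f u" for w m
  proof -
    define s where "s = 1 / (2 * L)"
    have s: "0 < s" "s \<le> 1" using L(2) by (auto simp: s_def)
    define u where "u = w - s *\<^sub>R g w"
    have "s * norm (g w) \<le> G"
      using mult_mono[of s 1 "norm (g w)" G] s G[OF \<open>w \<in> B\<close>] by auto
    moreover have "norm u \<le> norm w + s * norm (g w)"
      unfolding u_def using norm_triangle_ineq4[of w "s *\<^sub>R g w"] s by simp
    ultimately have "norm u \<le> R + G" "norm w \<le> R + G"
      using R[OF \<open>w \<in> B\<close>] G[OF \<open>w \<in> B\<close>] norm_ge_zero[of "g w"] by linarith+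
    then have "norm (g u - g w) \<le> L * norm (u - w)"
      using lipschitz_onD[OF L(1), of u w] by (simp add: dist_norm)
    also have "\<dots> = L * s * norm (g w)"
      using s by (simp add: u_def)
    finally have "norm (g u - g w) \<le> L * s * norm (g w)" .
    then have "norm (g u - g w) * norm (g w) \<le> L * s * norm (g w) * norm (g w)"
      by (rule mult_right_mono) simp
    moreover have "- inner (g u - g w) (g w) \<le> norm (g u - g w) * norm (g w)"
      using norm_cauchy_schwarz[of "- (g u - g w)" "g w"] by (simp add: inner_diff_left norm_minus_commute)
    ultimately have "inner (g u) (g w) \<ge> (norm (g w))\<^sup>2 - L * s * (norm (g w))\<^sup>2"
      by (simp add: inner_diff_left power2_norm_eq_inner[symmetric] power2_eq_square algebra_simps)
    then have "inner (g u) (g w) \<ge> (norm (g w))\<^sup>2 / 2"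
      using L(2) by (simp add: s_def)
    then have "s * ((norm (g w))\<^sup>2 / 2) \<le> s * inner (g u) (g w)"
      using s by (intro mult_left_mono) auto
    moreover have "f w \<ge> f u + s * inner (g u) (g w)"
      using convex_on_gradient_inequality[OF cvx df, of u w] by (simp add: u_def)
    ultimately have "s * ((norm (g w))\<^sup>2 / 2) \<le> f w - m"
      using m[of u] by linarith
    then show ?thesis
      using L(2) by (simp add: s_def field_simps)
  qed
  then show ?thesis
    using that[of L] L(2) by auto
qed

text \<open>Weak lower semicontinuity of the norm in disguise: otherwise every set \<open>f \<le> f z + \<mu>\<close> would meet
  the ball of radius \<open>sqrt r\<close>, and a common point \<open>p\<close> of these intersections would satisfy
  \<open>f p \<le> f z\<close> and \<open>norm p < norm z\<close>.\<close>

lemma ex_sublevel_norm_gt: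
  fixes f :: "'a::{real_inner, complete_space} \<Rightarrow> real"
  assumes cvx: "convex_on UNIV f" and cont: "continuous_on UNIV f"
    and min: "\<And>w. f w \<le> f z \<Longrightarrow> norm z \<le> norm w" and r: "r < (norm z)\<^sup>2"
  obtains \<mu> where "\<mu> > 0" "\<And>w. f w \<le> f z + \<mu> \<Longrightarrow> r < (norm w)\<^sup>2"
proof (rule ccontr)
  assume "\<not> thesis"
  with that have neg: "\<exists>w. f w \<le> f z + \<mu> \<and> (norm w)\<^sup>2 \<le> r" if "\<mu> > 0" for \<mu>
    using that by (metis not_le)
  define C where "C n = {w. f w \<le> f z + 1 / real (Suc n)} \<inter> cball 0 (sqrt r)" for n
  have "(\<Inter>n. C n) \<noteq> {}"
  proof (rule nested_closed_convex_bounded_Inter_nonempty)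
    fix n
    show "C n \<noteq> {}"
    proof -
      obtain w where "f w \<le> f z + 1 / real (Suc n)" "(norm w)\<^sup>2 \<le> r"
        using neg[of "1 / real (Suc n)"] by auto
      then have "w \<in> C n"
        by (simp add: C_def real_le_rsqrt del: of_nat_Suc)
      then show ?thesis by blast
    qed
    show "closed (C n)"
      unfolding C_def using cont by (intro closed_Int closed_Collect_le) auto
    show "convex (C n)"
      unfolding C_def
    proof (intro convex_Int convex_cball)
      show "convex {w. f w \<le> f z + 1 / real (Suc n)}"
        by (rule convex_sublevel[OF cvx])
    qed
  next
    show "C n \<subseteq> C m" if "m \<le> n" for m n
    proof -
      have "1 / real (Suc n) \<le> 1 / real (Suc m)"
        using that by (intro divide_left_mono) auto
      then show ?thesis
        unfolding C_def by (auto simp del: of_nat_Suc)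
    qed
  next
    show "bounded (C 0)"
      unfolding C_def by (rule bounded_subset[OF bounded_cball]) auto
  qed
  then obtain p where p: "\<And>n. p \<in> C n" by blast
  have "(\<lambda>n. f z + 1 / real (Suc n)) \<longlonglongrightarrow> f z + 0"
    by (intro tendsto_add tendsto_const LIMSEQ_Suc[OF lim_1_over_n])
  moreover have "f p \<le> f z + 1 / real (Suc n)" for n
    using p[of n] by (simp add: C_def del: of_nat_Suc)
  ultimately have "f p \<le> f z"
    using LIMSEQ_le_const[of "\<lambda>n. f z + 1 / real (Suc n)" "f z" "f p"] by auto
  then have "norm z \<le> sqrt r"
    using min[of p] p[of 0] by (simp add: C_def)
  then have "(norm z)\<^sup>2 \<le> r"
    using neg[of 1] by (smt (verit) norm_ge_zero real_sqrt_pow2_iff power_mono zero_le_power2)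
  with r show False by simp
qed

section \<open>Comparison for Euler-type differential inequalities\<close>

text \<open>The integrating factor is \<open>t powr p\<close>.\<close>

lemma euler_comparison:
  fixes k :: "real \<Rightarrow> real"
  assumes T: "T > 0"
    and dk: "\<And>t. t \<ge> T \<Longrightarrow> (k has_real_derivative k' t) (at t within {T..})"
    and le: "\<And>t. t \<ge> T \<Longrightarrow> k' t \<le> p / t * (C - k t)"
    and t: "t \<ge> T"
  shows "k t \<le> C + (T / t) powr p * (k T - C)"
proof -
  define \<phi> where "\<phi> s = s powr p * (k s - C)" for s
  have d: "(\<phi> has_real_derivative p * s powr (p - 1) * (k s - C) + k' s * s powr p) (at s within {T..})"
    if "s \<ge> T" for s
    unfolding \<phi>_def
    using DERIV_mult[OF has_field_derivative_at_within[OF has_real_derivative_powr[of s p]]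
        DERIV_diff[OF dk[OF that] DERIV_const[of C]]] that T
    by simp
  have "\<phi> t \<le> \<phi> T"
  proof (rule DERIV_nonpos_imp_decreasing_open[OF t])
    fix s
    assume s: "T < s" "s < t"
    then have "at s within {T..} = at s"
      by (intro at_within_interior) (auto simp: interior_Ici)
    moreover have "p * s powr (p - 1) * (k s - C) + k' s * s powr p \<le> 0"
    proof -
      have "k' s * s powr p \<le> p / s * (C - k s) * s powr p"
        using le[of s] s by (intro mult_right_mono) auto
      also have "\<dots> = - (p * s powr (p - 1) * (k s - C))"
        using s T by (simp add: powr_diff field_simps)
      finally show ?thesis by simp
    qed
    ultimately show "\<exists>y. (\<phi> has_real_derivative y) (at s) \<and> y \<le> 0"
      using d[of s] s by auto
  next
    have "continuous_on {T..} \<phi>"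
      by (rule DERIV_continuous_on[where D = "\<lambda>s. p * s powr (p - 1) * (k s - C) + k' s * s powr p"])
         (use d in auto)
    then show "continuous_on {T..t} \<phi>"
      by (rule continuous_on_subset) auto
  qed
  then have "k t - C \<le> T powr p * (k T - C) / t powr p"
    using t T by (simp add: \<phi>_def field_simps)
  then show ?thesis
    using t T by (simp add: powr_divide)
qed

lemma euler_comparison_bounded:
  fixes k :: "real \<Rightarrow> real"
  assumes "T > 0" "p \<ge> 0"
    and "\<And>t. t \<ge> T \<Longrightarrow> (k has_real_derivative k' t) (at t within {T..})"
    and "\<And>t. t \<ge> T \<Longrightarrow> k' t \<le> p / t * (C - k t)"
    and "t \<ge> T"
  shows "k t \<le> C + \<bar>k T - C\<bar>"
proof -
  have "(T / t) powr p \<le> 1"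
    using powr_mono2[of p "T / t" 1] assms by simp
  then have "(T / t) powr p * \<bar>k T - C\<bar> \<le> \<bar>k T - C\<bar>"
    using mult_right_mono[of "(T / t) powr p" 1 "\<bar>k T - C\<bar>"] by simp
  moreover have "(T / t) powr p * (k T - C) \<le> (T / t) powr p * \<bar>k T - C\<bar>"
    by (intro mult_left_mono) auto
  ultimately show ?thesis
    using euler_comparison[OF assms(1,3,4,5)] by linarith
qed

text \<open>From some time \<open>T2\<close> on the forcing \<open>w\<close> is at most \<open>e / 2\<close>, and the comparison with this constant
  forcing forgets the value of \<open>k\<close> at \<open>T2\<close>. The hypothesis on \<open>w\<close> is one-sided because in the
  application \<open>w = (\<parallel>z\<parallel>\<^sup>2 - \<parallel>y\<parallel>\<^sup>2) / 2\<close> only an upper bound is at hand.\<close>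

lemma euler_comparison_tendsto_0:
  fixes k :: "real \<Rightarrow> real"
  assumes T: "T > 0" and p: "p > 0" and nonneg: "\<And>t. 0 \<le> k t"
    and dk: "\<And>t. t \<ge> T \<Longrightarrow> (k has_real_derivative k' t) (at t within {T..})"
    and le: "\<And>t. t \<ge> T \<Longrightarrow> k' t \<le> p / t * (w t - k t)"
    and w: "\<And>\<eta>. \<eta> > 0 \<Longrightarrow> \<forall>\<^sub>F t in at_top. w t \<le> \<eta>"
  shows "(k \<longlongrightarrow> 0) at_top"
proof (rule tendstoI)
  fix e :: real
  assume "e > 0"
  then have "\<forall>\<^sub>F t in at_top. w t \<le> e / 2"
    by (intro w) simp
  then obtain T1 where T1: "\<And>t. t \<ge> T1 \<Longrightarrow> w t \<le> e / 2"
    by (auto simp: eventually_at_top_linorder)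
  define T2 where "T2 = max T T1"
  have T2: "T2 > 0" "T2 \<ge> T" "T2 \<ge> T1" using T by (auto simp: T2_def)
  have le2: "k t \<le> e / 2 + (T2 / t) powr p * (k T2 - e / 2)" if "t \<ge> T2" for t
  proof (rule euler_comparison[where k' = k'])
    show "(k has_real_derivative k' s) (at s within {T2..})" if "s \<ge> T2" for s
      using DERIV_subset[OF dk[of s], of "{T2..}"] that T2 by auto
    show "k' s \<le> p / s * (e / 2 - k s)" if "s \<ge> T2" for s
    proof -
      have "p / s * (w s - k s) \<le> p / s * (e / 2 - k s)"
        using T1[of s] that T2 p by (intro mult_left_mono) auto
      then show ?thesis using le[of s] that T2 by simp
    qed
  qed (use that T2 in auto)
  have "((\<lambda>t. T2 / t) \<longlongrightarrow> 0) at_top"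
    by (intro tendsto_divide_0[OF tendsto_const] filterlim_at_top_imp_at_infinity filterlim_ident)
  then have "((\<lambda>t. (T2 / t) powr p) \<longlongrightarrow> 0) at_top"
  proof (rule tendsto_zero_powrI)
    show "\<forall>\<^sub>F t in at_top. 0 \<le> T2 / t"
      using eventually_gt_at_top[of 0] by eventually_elim (use T2 in auto)
  qed (use p in auto)
  then have "((\<lambda>t. e / 2 + (T2 / t) powr p * (k T2 - e / 2)) \<longlongrightarrow> e / 2 + 0 * (k T2 - e / 2)) at_top"
    by (intro tendsto_intros)
  then have "\<forall>\<^sub>F t in at_top. e / 2 + (T2 / t) powr p * (k T2 - e / 2) < e"
    by (rule order_tendstoD(2)) (use \<open>e > 0\<close> in simp)
  then show "\<forall>\<^sub>F t in at_top. dist (k t) 0 < e"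
    using eventually_ge_at_top[of T2]
  proof eventually_elim
    case (elim t)
    then show ?case using le2[of t] nonneg[of t] by (simp add: dist_real_def)
  qed
qed

section \<open>Steepest descent with a vanishing Tikhonov term\<close>

lemma has_real_derivative_half_dist_power2:
  fixes y :: "real \<Rightarrow> 'a::real_inner"
  assumes "(y has_vector_derivative v) (at t within S)"
  shows "((\<lambda>t. (norm (y t - z))\<^sup>2 / 2) has_real_derivative inner (y t - z) v) (at t within S)"
proof -
  have d: "((\<lambda>t. y t - z) has_derivative (\<lambda>s. s *\<^sub>R v)) (at t within S)"
    using assms unfolding has_vector_derivative_def by (auto intro!: derivative_eq_intros)
  have "((\<lambda>t. inner (y t - z) (y t - z) * (1 / 2)) has_derivative
      (\<lambda>s. (inner (y t - z) (s *\<^sub>R v) + inner (s *\<^sub>R v) (y t - z)) * (1 / 2))) (at t within S)"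
    by (intro has_derivative_mult_left has_derivative_inner d)
  moreover have "(\<lambda>s. (inner (y t - z) (s *\<^sub>R v) + inner (s *\<^sub>R v) (y t - z)) * (1 / 2)) = (*) (inner (y t - z) v)"
    by (auto simp: inner_commute[of v])
  ultimately show ?thesis
    by (simp add: has_field_derivative_def power2_norm_eq_inner)
qed

lemma has_real_derivative_GDERIV_compose:
  assumes "(y has_vector_derivative v) (at t within S)" and "GDERIV f (y t) :> g"
  shows "((\<lambda>t. f (y t)) has_real_derivative inner g v) (at t within S)"
proof -
  have "((f \<circ> y) has_vector_derivative inner v g) (at t within S)"
    using vector_derivative_diff_chain_within[OF assms(1), of f "\<lambda>h. inner h g"] assms(2)
    unfolding gderiv_def by (auto intro: has_derivative_at_withinI)
  then show ?thesis
    by (simp add: has_real_derivative_iff_has_vector_derivative o_def inner_commute)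
qed

text \<open>The energy \<open>K\<close> is \<open>c t\<^sup>2\<close> times the regularized gap \<open>f y - f z + (\<epsilon> / 2) \<parallel>y\<parallel>\<^sup>2\<close>, plus
  \<open>\<parallel>y - z\<parallel>\<^sup>2 / 2\<close>. The regularized gap decreases along the flow, and the
  derivative of \<open>\<parallel>y - z\<parallel>\<^sup>2 / 2\<close> contains the term \<open>- (t / \<beta>) (f y - f z)\<close>, which pays for the growth of
  the factor \<open>t\<^sup>2\<close>; the value of \<open>c\<close> is the one for which the gap terms
  of \<open>K'\<close> add up to exactly \<open>- (2 \<delta> / t)\<close> times the gap term of \<open>K\<close>.\<close>

lemma tikhonov_flow_value_rate:
  fixes f :: "'a::real_inner \<Rightarrow> real"
  assumes cvx: "convex_on UNIV f" and df: "\<And>w. GDERIV f w :> g w"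
    and pos: "\<beta> > 0" "\<delta> > 0" "t0 > 0" and z: "\<And>w. f z \<le> f w"
    and y: "\<And>t. t \<ge> t0 \<Longrightarrow>
      (y has_vector_derivative - (t / \<beta>) *\<^sub>R (g (y t) + (2 * \<delta> * \<beta> / t\<^sup>2) *\<^sub>R y t)) (at t within {t0..})"
  obtains C where "\<And>t. t \<ge> t0 \<Longrightarrow> f (y t) - f z \<le> C / t\<^sup>2"
proof -
  define c where "c = 1 / (2 * \<beta> * (\<delta> + 1))"
  \<comment> \<open>\<open>y t - 0\<close> makes the rule for the derivative of half a squared distance apply\<close>
  define K where "K t = c * t\<^sup>2 * (f (y t) - f z) + \<delta> / (\<delta> + 1) * ((norm (y t - 0))\<^sup>2 / 2)
      + (norm (y t - z))\<^sup>2 / 2" for t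
  define v where "v t = - (t / \<beta>) *\<^sub>R (g (y t) + (2 * \<delta> * \<beta> / t\<^sup>2) *\<^sub>R y t)" for t
  define K' where "K' t = c * (2 * t) * (f (y t) - f z) + c * t\<^sup>2 * inner (g (y t)) (v t)
      + \<delta> / (\<delta> + 1) * inner (y t - 0) (v t) + inner (y t - z) (v t)" for t
  have c: "c > 0" using pos by (simp add: c_def)
  have dK: "(K has_real_derivative K' t) (at t within {t0..})" if "t \<ge> t0" for t
  proof -
    have dy: "(y has_vector_derivative v t) (at t within {t0..})"
      using y[OF that] by (simp add: v_def)
    show ?thesis
      unfolding K_def K'_def
      by (rule derivative_eq_intros has_real_derivative_half_dist_power2[OF dy]
            has_real_derivative_GDERIV_compose[OF dy df] refl | simp add: algebra_simps)+
  qed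
  have K'_le: "K' t \<le> 2 * \<delta> / t * ((norm z)\<^sup>2 / 2 - K t)" if "t \<ge> t0" for t
  proof -
    have t: "t > 0" using that pos by simp
    define e where "e = 2 * \<delta> * \<beta> / t\<^sup>2"
    define gap where "gap = f (y t) - f z"
    define A where "A = inner (y t) (y t)"
    define D where "D = (norm (y t - z))\<^sup>2"
    have ve: "v t = - (t / \<beta>) *\<^sub>R (g (y t) + e *\<^sub>R y t)"
      by (simp add: v_def e_def)
    have te: "t / \<beta> * e = 2 * \<delta> / t"
      using t pos by (simp add: e_def power2_eq_square)
    have ce: "\<delta> / (\<delta> + 1) = c * t\<^sup>2 * e"
      using t pos by (simp add: c_def e_def)
    \<comment> \<open>\<open>v t\<close> is a negative multiple of the gradient of the regularized function, which therefore
      decreases along the flow.\<close>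
    have "c * t\<^sup>2 * inner (g (y t)) (v t) + \<delta> / (\<delta> + 1) * inner (y t) (v t)
        = c * t\<^sup>2 * inner (g (y t) + e *\<^sub>R y t) (v t)"
      unfolding ce by (simp add: inner_add_left algebra_simps)
    also have "\<dots> = - (c * t\<^sup>2 * (t / \<beta>) * (norm (g (y t) + e *\<^sub>R y t))\<^sup>2)"
      by (simp add: ve power2_norm_eq_inner)
    also have "\<dots> \<le> 0"
      using c t pos by simp
    finally have 1: "c * t\<^sup>2 * inner (g (y t)) (v t) + \<delta> / (\<delta> + 1) * inner (y t) (v t) \<le> 0" .
    have "inner (y t - z) (v t) = - (t / \<beta>) * (inner (g (y t)) (y t - z) + e * inner (y t) (y t - z))"
      unfolding ve by (simp add: inner_add_left inner_commute[of "y t - z"])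
    also have "\<dots> \<le> - (t / \<beta>) * (gap + e * inner (y t) (y t - z))"
      using convex_on_gradient_inequality[OF cvx df, of "y t" z] t pos
      by (intro mult_left_mono_neg) (auto simp: inner_diff_right gap_def)
    also have "inner (y t) (y t - z) = (A + D - (norm z)\<^sup>2) / 2"
      by (simp add: A_def D_def power2_norm_eq_inner inner_simps inner_commute[of z "y t"] field_simps)
    also have "- (t / \<beta>) * (gap + e * ((A + D - (norm z)\<^sup>2) / 2))
        = - (t / \<beta>) * gap - (t / \<beta> * e) * ((A + D - (norm z)\<^sup>2) / 2)"
      using pos by (simp add: field_simps)
    finally have 2: "inner (y t - z) (v t) \<le> - (t / \<beta>) * gap - \<delta> / t * (A + D - (norm z)\<^sup>2)"
      unfolding te by simp
    have "\<delta> / t * (\<delta> / (\<delta> + 1) * A) \<le> \<delta> / t * A"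
      using t pos by (intro mult_left_mono) (auto simp: A_def field_simps)
    moreover have "c * (2 * t) * gap - (t / \<beta>) * gap = - (2 * \<delta> / t * (c * t\<^sup>2 * gap))"
    proof -
      have "\<delta> + 1 \<noteq> 0" using pos by simp
      then have "t / \<beta> = t * (2 * c * (\<delta> + 1))"
        using pos by (simp add: c_def del: distrib_left distrib_right)
      then show ?thesis
        using t by (simp add: power2_eq_square algebra_simps)
    qed
    moreover have "K' t \<le> c * (2 * t) * gap - (t / \<beta>) * gap - \<delta> / t * (A + D - (norm z)\<^sup>2)"
      using 1 2 by (simp add: K'_def gap_def)
    moreover have "2 * \<delta> / t * ((norm z)\<^sup>2 / 2 - K t) = - (2 * \<delta> / t * (c * t\<^sup>2 * gap))
        - \<delta> / t * (\<delta> / (\<delta> + 1) * A) - \<delta> / t * (D - (norm z)\<^sup>2)"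
    proof -
      define q where "q = \<delta> / (\<delta> + 1)"
      have "K t = c * t\<^sup>2 * gap + q * (A / 2) + D / 2"
        by (simp add: K_def gap_def D_def A_def q_def power2_norm_eq_inner)
      then show ?thesis
        unfolding q_def[symmetric] using t by (simp add: field_simps)
    qed
    moreover have "\<delta> / t * (A + D - (norm z)\<^sup>2) = \<delta> / t * A + \<delta> / t * (D - (norm z)\<^sup>2)"
      by (simp only: distrib_left[symmetric] add_diff_eq)
    ultimately show ?thesis
      by linarith
  qed
  define C where "C = ((norm z)\<^sup>2 / 2 + \<bar>K t0 - (norm z)\<^sup>2 / 2\<bar>) / c"
  have "f (y t) - f z \<le> C / t\<^sup>2" if "t \<ge> t0" for t
  proof -
    have "c * t\<^sup>2 * (f (y t) - f z) \<le> K t"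
      using pos by (simp add: K_def)
    also have "\<dots> \<le> c * C"
      using euler_comparison_bounded[OF _ _ dK K'_le that] pos c by (simp add: C_def)
    finally have "t\<^sup>2 * (f (y t) - f z) \<le> C"
      using c by simp
    then show ?thesis
      using that pos by (simp add: field_simps)
  qed
  then show ?thesis using that by blast
qed

text \<open>The Tikhonov term selects the limit. Expanding \<open>y \<bullet> (y - z)\<close> turns it into a relaxation of
  \<open>\<parallel>y - z\<parallel>\<^sup>2 / 2\<close> towards \<open>(\<parallel>z\<parallel>\<^sup>2 - \<parallel>y\<parallel>\<^sup>2) / 2\<close>, whose upper limit is at most \<open>0\<close> because the values
  \<open>f (y t)\<close> tend to the minimum.\<close>

lemma tikhonov_flow_tendsto_min_norm:
  fixes f :: "'a::{real_inner, complete_space} \<Rightarrow> real"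
  assumes cvx: "convex_on UNIV f" and df: "\<And>w. GDERIV f w :> g w"
    and pos: "\<beta> > 0" "\<delta> > 0" "t0 > 0" and z: "\<And>w. f z \<le> f w"
    and zmin: "\<And>w. f w \<le> f z \<Longrightarrow> norm z \<le> norm w"
    and y: "\<And>t. t \<ge> t0 \<Longrightarrow>
      (y has_vector_derivative - (t / \<beta>) *\<^sub>R (g (y t) + (2 * \<delta> * \<beta> / t\<^sup>2) *\<^sub>R y t)) (at t within {t0..})"
  shows "(y \<longlongrightarrow> z) at_top"
proof -
  define v where "v t = - (t / \<beta>) *\<^sub>R (g (y t) + (2 * \<delta> * \<beta> / t\<^sup>2) *\<^sub>R y t)" for t
  have cont: "continuous_on UNIV f"
    by (rule GDERIV_imp_continuous_on[OF df])
  obtain C where C: "\<And>t. t \<ge> t0 \<Longrightarrow> f (y t) - f z \<le> C / t\<^sup>2"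
    using tikhonov_flow_value_rate[OF cvx df pos z y] by blast
  have "((\<lambda>t. (norm (y t - z))\<^sup>2 / 2) \<longlongrightarrow> 0) at_top"
  proof (rule euler_comparison_tendsto_0)
    fix t :: real
    assume "t \<ge> t0"
    then show "((\<lambda>t. (norm (y t - z))\<^sup>2 / 2) has_real_derivative inner (y t - z) (v t)) (at t within {t0..})"
      unfolding v_def by (intro has_real_derivative_half_dist_power2 y)
    have t: "t > 0" using \<open>t \<ge> t0\<close> pos by simp
    have "inner (g (y t)) (y t - z) \<ge> 0"
      using convex_on_gradient_inequality[OF cvx df, of "y t" z] z[of "y t"] by (simp add: inner_diff_right)
    then have "t / \<beta> * inner (g (y t)) (y t - z) \<ge> 0"
      using t pos by simp
    moreover have "inner (y t - z) (v t)
        = - (t / \<beta> * inner (g (y t)) (y t - z)) - 2 * \<delta> / t * inner (y t) (y t - z)"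
      using t pos by (simp add: v_def inner_simps inner_commute field_simps power2_eq_square)
    ultimately have "inner (y t - z) (v t) \<le> - (2 * \<delta> / t * inner (y t) (y t - z))"
      by linarith
    also have "inner (y t) (y t - z) = (norm (y t - z))\<^sup>2 / 2 - ((norm z)\<^sup>2 - (norm (y t))\<^sup>2) / 2"
      by (simp add: power2_norm_eq_inner inner_simps inner_commute[of z "y t"] field_simps)
    also have "- (2 * \<delta> / t * ((norm (y t - z))\<^sup>2 / 2 - ((norm z)\<^sup>2 - (norm (y t))\<^sup>2) / 2))
        = 2 * \<delta> / t * (((norm z)\<^sup>2 - (norm (y t))\<^sup>2) / 2 - (norm (y t - z))\<^sup>2 / 2)"
      by (simp only: mult_minus_right[symmetric] minus_diff_eq)
    finally show "inner (y t - z) (v t)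
        \<le> 2 * \<delta> / t * (((norm z)\<^sup>2 - (norm (y t))\<^sup>2) / 2 - (norm (y t - z))\<^sup>2 / 2)" .
  next
    fix \<eta> :: real
    assume "\<eta> > 0"
    then obtain \<mu> where \<mu>: "\<mu> > 0" "\<And>w. f w \<le> f z + \<mu> \<Longrightarrow> (norm z)\<^sup>2 - 2 * \<eta> < (norm w)\<^sup>2"
      using ex_sublevel_norm_gt[OF cvx cont zmin, of "(norm z)\<^sup>2 - 2 * \<eta>"] by auto
    have "((\<lambda>t. C / t\<^sup>2) \<longlongrightarrow> 0) at_top"
      by (intro tendsto_divide_0[OF tendsto_const] filterlim_at_top_imp_at_infinity
          filterlim_pow_at_top filterlim_ident) simp
    then have "\<forall>\<^sub>F t in at_top. C / t\<^sup>2 < \<mu>"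
      by (rule order_tendstoD(2)) (use \<mu> in simp)
    then show "\<forall>\<^sub>F t in at_top. ((norm z)\<^sup>2 - (norm (y t))\<^sup>2) / 2 \<le> \<eta>"
      using eventually_ge_at_top[of t0]
    proof eventually_elim
      case (elim t)
      then have "f (y t) \<le> f z + \<mu>" using C[of t] by simp
      then show ?case using \<mu>(2)[of "y t"] by simp
    qed
  qed (use pos in auto)
  then have "((\<lambda>t. sqrt (2 * ((norm (y t - z))\<^sup>2 / 2))) \<longlongrightarrow> sqrt (2 * 0)) at_top"
    by (intro tendsto_intros)
  then show ?thesis
    by (simp add: tendsto_norm_zero_iff LIM_zero_iff)
qed

section \<open>Weighted means of a trajectory\<close>

text \<open>The equation says \<open>(t powr \<beta> * x)' = \<beta> * t powr (\<beta> - 1) * y\<close>, so \<open>x\<close> averages \<open>y\<close> with weights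
  whose mass moves to infinity.\<close>

lemma weighted_mean_tendsto:
  fixes x y :: "real \<Rightarrow> 'a::real_inner"
  assumes pos: "\<beta> > 0" "t0 > 0"
    and x: "\<And>t. t \<ge> t0 \<Longrightarrow> (x has_vector_derivative (\<beta> / t) *\<^sub>R (y t - x t)) (at t within {t0..})"
    and y: "(y \<longlongrightarrow> z) at_top"
  shows "(x \<longlongrightarrow> z) at_top"
proof -
  have "((\<lambda>t. (norm (x t - z))\<^sup>2 / 2) \<longlongrightarrow> 0) at_top"
  proof (rule euler_comparison_tendsto_0)
    fix t :: real
    assume "t \<ge> t0"
    then show "((\<lambda>t. (norm (x t - z))\<^sup>2 / 2) has_real_derivative
        inner (x t - z) ((\<beta> / t) *\<^sub>R (y t - x t))) (at t within {t0..})"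
      by (intro has_real_derivative_half_dist_power2 x)
    have "inner (x t - z) (y t - x t) \<le> (norm (y t - z))\<^sup>2 / 2 - (norm (x t - z))\<^sup>2 / 2"
      using inner_ge_zero[of "y t - x t"]
      by (simp add: power2_norm_eq_inner inner_simps inner_commute field_simps)
    then have "\<beta> / t * inner (x t - z) (y t - x t) \<le> \<beta> / t * ((norm (y t - z))\<^sup>2 / 2 - (norm (x t - z))\<^sup>2 / 2)"
      using pos \<open>t \<ge> t0\<close> by (intro mult_left_mono) auto
    then show "inner (x t - z) ((\<beta> / t) *\<^sub>R (y t - x t))
        \<le> \<beta> / t * ((norm (y t - z))\<^sup>2 / 2 - (norm (x t - z))\<^sup>2 / 2)"
      by simp
  next
    fix \<eta> :: real
    assume "\<eta> > 0"
    have "((\<lambda>t. (norm (y t - z))\<^sup>2 / 2) \<longlongrightarrow> (norm (z - z))\<^sup>2 / 2) at_top"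
      by (intro tendsto_intros y) simp
    then have "\<forall>\<^sub>F t in at_top. (norm (y t - z))\<^sup>2 / 2 < \<eta>"
      by (rule order_tendstoD(2)) (use \<open>\<eta> > 0\<close> in simp)
    then show "\<forall>\<^sub>F t in at_top. (norm (y t - z))\<^sup>2 / 2 \<le> \<eta>"
      by eventually_elim simp
  qed (use pos in auto)
  then have "((\<lambda>t. sqrt (2 * ((norm (x t - z))\<^sup>2 / 2))) \<longlongrightarrow> sqrt (2 * 0)) at_top"
    by (intro tendsto_intros)
  then show ?thesis
    by (simp add: tendsto_norm_zero_iff LIM_zero_iff)
qed

text \<open>Convexity gives \<open>(f x - m)' \<le> (\<beta> / t) ((f y - m) - (f x - m))\<close>. Multiplying by \<open>t\<^sup>2\<close> lowers the
  relaxation rate from \<open>\<beta>\<close> to \<open>\<beta> - 2\<close>, so \<open>\<beta> > 2\<close> keeps \<open>t\<^sup>2 (f x - m)\<close> bounded.\<close>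

lemma weighted_mean_value_rate:
  fixes f :: "'a::real_inner \<Rightarrow> real"
  assumes cvx: "convex_on UNIV f" and df: "\<And>w. GDERIV f w :> g w"
    and pos: "\<beta> > 2" "t0 > 0"
    and x: "\<And>t. t \<ge> t0 \<Longrightarrow> (x has_vector_derivative (\<beta> / t) *\<^sub>R (y t - x t)) (at t within {t0..})"
    and y: "\<And>t. t \<ge> t0 \<Longrightarrow> f (y t) - m \<le> C / t\<^sup>2"
  obtains C' where "\<And>t. t \<ge> t0 \<Longrightarrow> f (x t) - m \<le> C' / t\<^sup>2"
proof -
  define K where "K t = t\<^sup>2 * (f (x t) - m)" for t
  define K' where "K' t = 2 * t * (f (x t) - m) + t\<^sup>2 * inner (g (x t)) ((\<beta> / t) *\<^sub>R (y t - x t))" for t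
  define B where "B = \<beta> * C / (\<beta> - 2)"
  have dK: "(K has_real_derivative K' t) (at t within {t0..})" if "t \<ge> t0" for t
    unfolding K_def K'_def
    by (rule derivative_eq_intros has_real_derivative_GDERIV_compose[OF x[OF that] df] refl | simp add: algebra_simps)+
  have K'_le: "K' t \<le> (\<beta> - 2) / t * (B - K t)" if "t \<ge> t0" for t
  proof -
    have t: "t > 0" using that pos by simp
    have "inner (g (x t)) (y t - x t) \<le> C / t\<^sup>2 - (f (x t) - m)"
      using convex_on_gradient_inequality[OF cvx df, of "x t" "y t"] y[OF that] by simp
    then have "t * \<beta> * inner (g (x t)) (y t - x t) \<le> t * \<beta> * (C / t\<^sup>2 - (f (x t) - m))"
      using t pos by (intro mult_left_mono) auto
    also have "\<dots> = (\<beta> - 2) / t * (B - K t) - 2 * t * (f (x t) - m)"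
    proof -
      have "(\<beta> - 2) * B = \<beta> * C" using pos by (simp add: B_def)
      then have "(\<beta> - 2) / t * (B - K t) = \<beta> * C / t - (\<beta> - 2) / t * K t"
        by (simp add: right_diff_distrib)
      then show ?thesis
        using t by (simp add: K_def field_simps power2_eq_square)
    qed
    finally show ?thesis
      using t by (simp add: K'_def power2_eq_square algebra_simps)
  qed
  have "f (x t) - m \<le> (B + \<bar>K t0 - B\<bar>) / t\<^sup>2" if "t \<ge> t0" for t
    using euler_comparison_bounded[OF pos(2) _ dK K'_le that] pos that
    by (simp add: K_def[of t] field_simps)
  then show ?thesis using that by blast
qed

section \<open>Convergence of the inertial dynamics\<close>

theorem theorem6:
  fixes f :: "'a::{real_inner, complete_space} \<Rightarrow> real"
    and \<alpha> \<delta> t0 :: real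
    and x :: "real \<Rightarrow> 'a"
  assumes "convex_on UNIV f"
    and "class_C1 f"
    and "lipschitz_on_bounded_sets (gradient f)"
    and "argmin_set f \<noteq> {}"
    and "\<alpha> > 3" and "\<delta> > 1" and "t0 > 0"
    and "solution_trajectory f \<alpha> \<delta> t0 x"
  shows "(\<lambda>t. f (x t) - (INF y. f y)) \<in> O[at_top](\<lambda>t. 1 / t\<^sup>2) \<and>
    (x \<longlongrightarrow> arg_min_on norm (argmin_set f)) at_top \<and>
    (\<lambda>t. norm (gradient f (x t))) \<in> O[at_top](\<lambda>t. 1 / t)"
proof -
  define \<beta> where "\<beta> = \<alpha> - 1"
  have \<beta>: "\<beta> > 2" using assms(5) by (simp add: \<beta>_def)
  note df = GDERIV_gradient[OF assms(2)]
  have cont: "continuous_on UNIV f"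
    by (rule GDERIV_imp_continuous_on[OF df])
  have argmin: "argmin_set f = {w. \<forall>u. f w \<le> f u}"
    by (simp add: argmin_set_def is_arg_min_linorder)
  define z where "z = arg_min_on norm (argmin_set f)"
  have "closed (argmin_set f)"
    unfolding argmin by (intro closed_Collect_all closed_Collect_le cont continuous_on_const)
  moreover have "convex (argmin_set f)"
    unfolding argmin Collect_all_eq by (intro convex_INT convex_sublevel assms(1))
  ultimately obtain p where "is_arg_min norm (\<lambda>w. w \<in> argmin_set f) p"
    using ex_min_norm[OF _ _ assms(4)] unfolding is_arg_min_linorder by blast
  then have "is_arg_min norm (\<lambda>w. w \<in> argmin_set f) z"
    unfolding z_def arg_min_on_def arg_min_def by (rule someI)
  then have z: "\<And>w. f z \<le> f w" and zmin: "\<And>w. f w \<le> f z \<Longrightarrow> norm z \<le> norm w"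
    unfolding is_arg_min_linorder argmin by (auto, meson order_trans)
  have INF: "(INF w. f w) = f z"
    using z by (intro antisym cINF_lower cINF_greatest bdd_belowI2[where m = "f z"]) auto

  obtain v a where
    dx: "\<And>t. t \<ge> t0 \<Longrightarrow> (x has_vector_derivative v t) (at t within {t0..})" and
    dv: "\<And>t. t \<ge> t0 \<Longrightarrow> (v has_vector_derivative a t) (at t within {t0..})" and
    ode: "\<And>t. t \<ge> t0 \<Longrightarrow> a t + ((\<alpha> + 2 * \<delta>) / t) *\<^sub>R v t
      + gradient f (x t + (t / (\<alpha> - 1)) *\<^sub>R v t) + (2 * \<delta> * (\<alpha> - 1) / t\<^sup>2) *\<^sub>R x t = 0"
    using assms(8) unfolding solution_trajectory_def by blast
  define y where "y t = x t + (t / \<beta>) *\<^sub>R v t" for t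
  have x: "(x has_vector_derivative (\<beta> / t) *\<^sub>R (y t - x t)) (at t within {t0..})" if "t \<ge> t0" for t
    using dx[OF that] that assms(7) \<beta> by (simp add: y_def)
  have y: "(y has_vector_derivative - (t / \<beta>) *\<^sub>R (gradient f (y t) + (2 * \<delta> * \<beta> / t\<^sup>2) *\<^sub>R y t))
      (at t within {t0..})" if "t \<ge> t0" for t
  proof -
    have t: "t > 0" using that assms(7) by simp
    have "((\<lambda>t. t / \<beta>) has_real_derivative 1 / \<beta>) (at t within {t0..})"
      using \<beta> by (auto intro!: derivative_eq_intros)
    from has_vector_derivative_add[OF dx[OF that] has_vector_derivative_scaleR[OF this dv[OF that]]]
    have d: "(y has_vector_derivative v t + ((t / \<beta>) *\<^sub>R a t + (1 / \<beta>) *\<^sub>R v t)) (at t within {t0..})"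
      by (simp add: y_def[abs_def])
    have at: "a t = - (((\<beta> + 1 + 2 * \<delta>) / t) *\<^sub>R v t) - gradient f (y t) - (2 * \<delta> * \<beta> / t\<^sup>2) *\<^sub>R x t"
      using ode[OF that] by (simp add: y_def \<beta>_def algebra_simps eq_neg_iff_add_eq_0)
    have "(t / \<beta>) *\<^sub>R a t = - (t / \<beta>) *\<^sub>R (gradient f (y t) + (2 * \<delta> * \<beta> / t\<^sup>2) *\<^sub>R x t)
        - ((\<beta> + 1 + 2 * \<delta>) / \<beta>) *\<^sub>R v t"
      unfolding at using t by (simp add: scaleR_diff_right scaleR_add_right)
    moreover have "(t / \<beta>) *\<^sub>R (2 * \<delta> * \<beta> / t\<^sup>2) *\<^sub>R y t
        = (t / \<beta>) *\<^sub>R (2 * \<delta> * \<beta> / t\<^sup>2) *\<^sub>R x t + (2 * \<delta> / \<beta>) *\<^sub>R v t"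
      using t \<beta> by (simp add: y_def scaleR_add_right power2_eq_square)
    moreover have "((\<beta> + 1 + 2 * \<delta>) / \<beta>) *\<^sub>R v t = v t + (1 / \<beta>) *\<^sub>R v t + (2 * \<delta> / \<beta>) *\<^sub>R v t"
      using \<beta> by (simp add: scaleR_add_left add_divide_distrib)
    ultimately have "v t + ((t / \<beta>) *\<^sub>R a t + (1 / \<beta>) *\<^sub>R v t)
        = - (t / \<beta>) *\<^sub>R (gradient f (y t) + (2 * \<delta> * \<beta> / t\<^sup>2) *\<^sub>R y t)"
      by (simp add: scaleR_add_right)
    with d show ?thesis by simp
  qed

  have pos: "\<beta> > 0" "\<delta> > 0" "t0 > 0" using \<beta> assms by auto
  obtain C where "\<And>t. t \<ge> t0 \<Longrightarrow> f (y t) - f z \<le> C / t\<^sup>2"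
    using tikhonov_flow_value_rate[OF assms(1) df pos z y] by blast
  then obtain C' where C': "\<And>t. t \<ge> t0 \<Longrightarrow> f (x t) - f z \<le> C' / t\<^sup>2"
    using weighted_mean_value_rate[OF assms(1) df \<beta> pos(3) x] by blast
  have lim: "(x \<longlongrightarrow> z) at_top"
    using weighted_mean_tendsto[OF pos(1,3) x tikhonov_flow_tendsto_min_norm[OF assms(1) df pos z zmin y]] .

  have value_rate: "(\<lambda>t. f (x t) - (INF w. f w)) \<in> O[at_top](\<lambda>t. 1 / t\<^sup>2)"
  proof (rule bigoI)
    show "\<forall>\<^sub>F t in at_top. norm (f (x t) - (INF w. f w)) \<le> C' * norm (1 / t\<^sup>2)"
      using eventually_ge_at_top[of t0]
      by eventually_elim (use C' z in \<open>simp add: INF\<close>)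
  qed
  \<comment> \<open>the trajectory eventually stays in the unit ball around its limit\<close>
  obtain L where L: "L > 0"
    "\<And>w m. w \<in> cball z 1 \<Longrightarrow> (\<And>u. m \<le> f u) \<Longrightarrow> (norm (gradient f w))\<^sup>2 \<le> 4 * L * (f w - m)"
    using gradient_norm_le_gap[OF assms(1) df assms(3) bounded_cball] by blast
  have "(\<lambda>t. norm (gradient f (x t))) \<in> O[at_top](\<lambda>t. 1 / t)"
  proof (rule bigoI)
    have "\<forall>\<^sub>F t in at_top. dist (x t) z < 1"
      using lim by (rule tendstoD) simp
    then show "\<forall>\<^sub>F t in at_top. norm (norm (gradient f (x t))) \<le> sqrt (4 * L * C') * norm (1 / t)"
      using eventually_ge_at_top[of t0]
    proof eventually_elim
      case (elim t)
      have t: "t > 0" using elim pos by simp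
      have "(norm (gradient f (x t)))\<^sup>2 \<le> 4 * L * (f (x t) - f z)"
        using elim z by (intro L(2)) (auto simp: dist_commute)
      also have "\<dots> \<le> 4 * L * (C' / t\<^sup>2)"
        using C'[OF elim(2)] L(1) by (intro mult_left_mono) auto
      finally have "norm (gradient f (x t)) \<le> sqrt (4 * L * C' / t\<^sup>2)"
        by (intro real_le_rsqrt) simp
      also have "\<dots> = sqrt (4 * L * C') * (1 / t)"
        using t by (simp add: real_sqrt_divide)
      finally show ?case using t by simp
    qed
  qed
  with value_rate lim show ?thesis
    by (simp add: z_def)
qed

end
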